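(* Let $n,k,q$ be integers with $1\le k\le n-1$ and $q\ge 2$. Let $X=(X_1,\dots,X_n)$ be a vector of jointly distributed random variables, each taking values in a finite set of cardinality $q$, and suppose that $$\mathcal{C}^{(k)}(X)=k\binom{n-1}{k}.$$ Then the function $A\mapsto H(X_A)$ on subsets $A$ of $\{1,\dots,n\}$ is the rank function of a matroid on $\{1,\dots,n\}$, whose independent sets are the subsets $A$ with $H(X_A)=|A|$; and these independent sets are exactly the subsets of cardinality at most $k$, i.e. the matroid is isomorphic to the uniform matroid $U_{k,n}$.
   Context: Shannon entropy is taken with logarithms to base $q$: $H(Y)=\sum_y p(y)\log_q(1/p(y))$. For $A\subseteq\{1,\dots,n\}$ write $X_A=(X_i)_{i\in A}$, with $H(X_\emptyset)=0$. For $1\le k\le n-1$, the Cohesion-$k$ measure is $$\mathcal{C}^{(k)}(X)=\sum_{A\subseteq\{1,\dots,n\},\,|A|=k}H(X_A)-\binom{n-1}{k-1}H(X).$$ A (matroid) rank function on a finite set $E$ is a function $f:2^E\to\mathbb{Z}_{\ge0}$ that satisfies $f(\emptyset)=0$, $f(S)\le|S|$, is monotone ($S\subseteq T\Rightarrow f(S)\le f(T)$) and submodular ($f(S\cup T)+f(S\cap T)\le f(S)+f(T)$); the independent sets of the associated matroid are the sets $S$ with $f(S)=|S|$. The uniform matroid $U_{k,n}$ is the matroid on an $n$-element set whose independent sets are all subsets of cardinality at most $k$. *)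

theory Defs
  imports "HOL-Probability.Probability"
begin

section \<open>Joint entropies of a random vector and the Cohesion measure\<close>

definition subvector :: "(nat \<Rightarrow> 'a \<Rightarrow> 'b) \<Rightarrow> nat set \<Rightarrow> 'a \<Rightarrow> (nat \<Rightarrow> 'b)" where
  "subvector X A = (\<lambda>\<omega>. \<lambda>i\<in>A. X i \<omega>)"

text \<open>The right-hand side is what the notation for Shannon entropy inside the locale
  \<^locale>\<open>information_space\<close> abbreviates; \<open>joint_entropy_eq_sum\<close> below gives the sum formula.\<close>

definition joint_entropy :: "'a measure \<Rightarrow> real \<Rightarrow> (nat \<Rightarrow> 'a \<Rightarrow> 'b) \<Rightarrow> nat set \<Rightarrow> real" where
  "joint_entropy M b X A =
     prob_space.entropy M b (count_space (subvector X A ` space M)) (subvector X A)"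

definition cohesion :: "'a measure \<Rightarrow> real \<Rightarrow> nat \<Rightarrow> nat \<Rightarrow> (nat \<Rightarrow> 'a \<Rightarrow> 'b) \<Rightarrow> real" where
  "cohesion M b n k X =
     (\<Sum>A | A \<subseteq> {1..n} \<and> card A = k. joint_entropy M b X A)
       - real ((n - 1) choose (k - 1)) * joint_entropy M b X {1..n}"

lemma joint_entropy_eq_sum:
  assumes M: "prob_space M" and b: "1 < b" and A: "finite A"
    and S: "\<And>i. i \<in> A \<Longrightarrow> finite (S i)"
    and X: "\<And>i. i \<in> A \<Longrightarrow> X i \<in> M \<rightarrow>\<^sub>M count_space (S i)"
  defines "p \<equiv> \<lambda>y. measure M {\<omega> \<in> space M. \<forall>i\<in>A. X i \<omega> = y i}"
  shows "joint_entropy M b X A = (\<Sum>y\<in>Pi\<^sub>E A S. p y * log b (1 / p y))"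
proof -
  interpret prob_space M by fact
  interpret information_space M b by standard (rule b)
  let ?Y = "subvector X A"
  have sub: "?Y ` space M \<subseteq> Pi\<^sub>E A S"
    using measurable_space[OF X] by (auto simp: subvector_def)
  have fin: "finite (Pi\<^sub>E A S)"
    using A S by (intro finite_PiE) auto
  have eq: "?Y \<omega> = y \<longleftrightarrow> (\<forall>i\<in>A. X i \<omega> = y i)" if "y \<in> Pi\<^sub>E A S" for \<omega> y
    using that by (auto simp: subvector_def fun_eq_iff PiE_def extensional_def restrict_def)
  have meas: "{\<omega> \<in> space M. \<forall>i\<in>A. X i \<omega> = y i} \<in> sets M" if "y \<in> Pi\<^sub>E A S" for y
  proof (rule sets.sets_Collect_finite_All[OF _ A])
    fix i assume "i \<in> A"
    then have "X i -` {y i} \<inter> space M \<in> sets M"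
      using that X by (intro measurable_sets[where A = "count_space (S i)"]) auto
    also have "X i -` {y i} \<inter> space M = {\<omega> \<in> space M. X i \<omega> = y i}"
      by auto
    finally show "{\<omega> \<in> space M. X i \<omega> = y i} \<in> sets M" .
  qed
  have p: "p y = prob (?Y -` {y} \<inter> space M)" if "y \<in> Pi\<^sub>E A S" for y
    unfolding p_def using eq[OF that] by (intro arg_cong[where f = prob]) auto
  have "simple_function M ?Y"
    unfolding simple_function_def
  proof (intro conjI ballI)
    show "finite (?Y ` space M)"
      using sub fin by (rule finite_subset)
    fix y assume "y \<in> ?Y ` space M"
    then have y: "y \<in> Pi\<^sub>E A S"
      using sub by auto
    have "?Y -` {y} \<inter> space M = {\<omega> \<in> space M. \<forall>i\<in>A. X i \<omega> = y i}"
      using eq[OF y] by auto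
    then show "?Y -` {y} \<inter> space M \<in> sets M"
      using meas[OF y] by simp
  qed
  then have "simple_distributed M ?Y p"
    using p sub by (intro simple_distributedI) (auto simp: p_def)
  then have "joint_entropy M b X A = - (\<Sum>y\<in>?Y ` space M. p y * log b (p y))"
    unfolding joint_entropy_def by (rule entropy_simple_distributed)
  also have "\<dots> = (\<Sum>y\<in>?Y ` space M. p y * log b (1 / p y))"
    by (simp add: sum_negf[symmetric] log_inverse inverse_eq_divide[symmetric])
  also have "\<dots> = (\<Sum>y\<in>Pi\<^sub>E A S. p y * log b (1 / p y))"
  proof (rule sum.mono_neutral_left[OF fin sub], intro ballI)
    fix y assume y: "y \<in> Pi\<^sub>E A S - ?Y ` space M"
    then have "?Y -` {y} \<inter> space M = {}"
      by auto
    then show "p y * log b (1 / p y) = 0"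
      using p y by simp
  qed
  finally show ?thesis .
qed

section \<open>Matroids\<close>

text \<open>Rank functions are taken real-valued, so that entropies can be rank functions without
  coercion; integrality is part of the definition.\<close>

definition matroid_rank_function :: "'a set \<Rightarrow> ('a set \<Rightarrow> real) \<Rightarrow> bool" where
  "matroid_rank_function E f \<longleftrightarrow>
     finite E \<and>
     (\<forall>S. S \<subseteq> E \<longrightarrow> f S \<in> \<nat>) \<and>
     f {} = 0 \<and>
     (\<forall>S. S \<subseteq> E \<longrightarrow> f S \<le> real (card S)) \<and>
     (\<forall>S T. S \<subseteq> T \<and> T \<subseteq> E \<longrightarrow> f S \<le> f T) \<and>
     (\<forall>S T. S \<subseteq> E \<and> T \<subseteq> E \<longrightarrow> f (S \<union> T) + f (S \<inter> T) \<le> f S + f T)"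

text \<open>A matroid is given as the pair of its ground set and its family of independent sets.\<close>

type_synonym 'a matroid = "'a set \<times> 'a set set"

definition indep_sets_of_rank :: "'a set \<Rightarrow> ('a set \<Rightarrow> real) \<Rightarrow> 'a set set" where
  "indep_sets_of_rank E f = {S. S \<subseteq> E \<and> f S = real (card S)}"

definition matroid_of_rank :: "'a set \<Rightarrow> ('a set \<Rightarrow> real) \<Rightarrow> 'a matroid" where
  "matroid_of_rank E f = (E, indep_sets_of_rank E f)"

definition uniform_matroid :: "nat \<Rightarrow> nat \<Rightarrow> nat matroid" where
  "uniform_matroid k n = ({1..n}, {S. S \<subseteq> {1..n} \<and> card S \<le> k})"

definition matroid_isomorphic :: "'a matroid \<Rightarrow> 'b matroid \<Rightarrow> bool" where
  "matroid_isomorphic P Q \<longleftrightarrow>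
     (\<exists>\<phi>. bij_betw \<phi> (fst P) (fst Q) \<and>
       (\<forall>S. S \<subseteq> fst P \<longrightarrow> (S \<in> snd P \<longleftrightarrow> \<phi> ` S \<in> snd Q)))"

end

theory Submission
  imports Defs
begin

text \<open>Write \<open>h A\<close> for the entropy of \<open>X\<^sub>A\<close>. It is monotone and subadditive with \<open>h {i} \<le> 1\<close>, hence
  \<open>h A \<le> |A|\<close>. Both \<open>h A \<le> h E\<close> and \<open>h A \<le> k\<close> bound the sum over the \<open>k\<close>-subsets of \<open>E\<close>; by
  Pascal's rule, the cohesion equation turns the first bound into \<open>h E \<ge> k\<close> and the second one into
  \<open>h E \<le> k\<close>. So \<open>h E = k\<close> and, the second bound being attained, \<open>h A = k\<close> whenever \<open>|A| = k\<close>.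
  Monotonicity then gives \<open>h A = k\<close> for larger \<open>A\<close>, and subadditivity on a \<open>k\<close>-set containing \<open>A\<close>
  gives \<open>h A = |A|\<close> for smaller \<open>A\<close>.\<close>

lemma simple_function_finite_range:
  assumes "X \<in> M \<rightarrow>\<^sub>M count_space S" and "finite S"
  shows "simple_function M X"
proof -
  have "X ` space M \<subseteq> S"
    using measurable_space[OF assms(1)] by auto
  then show ?thesis
    using assms unfolding simple_function_def
    by (auto intro!: measurable_sets[OF assms(1)] intro: finite_subset)
qed

lemma simple_function_subvector:
  assumes "finite A" and "\<And>i. i \<in> A \<Longrightarrow> simple_function M (X i)"
  shows "simple_function M (subvector X A)"
  using assms
proof (induction A rule: finite_induct)
  case empty
  then show ?case by (simp add: subvector_def)
next
  case (insert j A)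
  \<comment> \<open>The tuple on \<open>insert j A\<close> is a function of the tuple on
    \<open>A\<close> paired with the new coordinate.\<close>
  have "simple_function M ((\<lambda>(v, y). v(j := y)) \<circ> (\<lambda>\<omega>. (subvector X A \<omega>, X j \<omega>)))"
    using insert by (intro simple_function_compose simple_function_Pair) auto
  also have "(\<lambda>(v, y). v(j := y)) \<circ> (\<lambda>\<omega>. (subvector X A \<omega>, X j \<omega>)) = subvector X (insert j A)"
    using insert.hyps by (auto simp: subvector_def fun_eq_iff restrict_def)
  finally show ?case .
qed

context information_space
begin

lemma joint_entropy_empty: "joint_entropy M b X {} = 0"
proof -
  \<comment> \<open>The empty tuple is a single default value, taken with probability 1, so its
    entropy is \<open>- log 1 = 0\<close>.\<close>
  have const: "subvector X {} = (\<lambda>_ _. undefined)"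
    by (auto simp: subvector_def fun_eq_iff)
  have "simple_function M (subvector X {})"
    by (rule simple_function_subvector) auto
  from entropy_simple_distributed[OF simple_distributedI[OF this measure_nonneg refl]]
  show ?thesis
    using not_empty by (simp add: joint_entropy_def const image_constant_conv prob_space)
qed

text \<open>Data processing inequality: restricting indices makes the tuple on \<open>A\<close> a
  function of the tuple on \<open>B\<close>.\<close>

lemma joint_entropy_mono:
  assumes "finite B" and "\<And>i. i \<in> B \<Longrightarrow> simple_function M (X i)" and "A \<subseteq> B"
  shows "joint_entropy M b X A \<le> joint_entropy M b X B"
proof -
  have "(\<lambda>v. restrict v A) \<circ> subvector X B = subvector X A"
    using \<open>A \<subseteq> B\<close> by (auto simp: subvector_def fun_eq_iff restrict_def)
  moreover have "simple_function M (subvector X B)"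
    using assms(1,2) by (rule simple_function_subvector)
  ultimately show ?thesis
    using entropy_data_processing[of "subvector X B" "\<lambda>v. restrict v A"]
    by (simp only: joint_entropy_def)
qed

text \<open>For the pair of tuples this is the chain rule together with the fact that conditioning
  does not increase entropy; data processing then passes from the pair to the union.\<close>

lemma joint_entropy_subadditive:
  fixes X :: "nat \<Rightarrow> 'a \<Rightarrow> 'c"
  assumes "finite A" and "finite B" and X: "\<And>i. i \<in> A \<union> B \<Longrightarrow> simple_function M (X i)"
  shows "joint_entropy M b X (A \<union> B) \<le> joint_entropy M b X A + joint_entropy M b X B"
proof -
  let ?P = "\<lambda>\<omega>. (subvector X A \<omega>, subvector X B \<omega>)"
  have sf: "simple_function M (subvector X A)" "simple_function M (subvector X B)"
    using assms by (auto intro: simple_function_subvector)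
  \<comment> \<open>\<open>A\<close> and \<open>B\<close> may overlap; \<open>f\<close> glues the
    two tuples and reads common coordinates from the first.\<close>
  define f :: "(nat \<Rightarrow> 'c) \<times> (nat \<Rightarrow> 'c) \<Rightarrow> nat \<Rightarrow> 'c"
    where "f = (\<lambda>(u, v). \<lambda>i\<in>A \<union> B. if i \<in> A then u i else v i)"
  have "f \<circ> ?P = subvector X (A \<union> B)"
    by (auto simp: f_def subvector_def fun_eq_iff restrict_def)
  then have "joint_entropy M b X (A \<union> B) \<le> entropy b (count_space (?P ` space M)) ?P"
    using entropy_data_processing[OF simple_function_Pair[OF sf], where f = f]
    by (simp only: joint_entropy_def)
  then show ?thesis
    using entropy_chain_rule[OF sf] conditional_entropy_less_eq_entropy[OF sf(2,1)]
    unfolding joint_entropy_def by linarith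
qed

text \<open>Entropy is at most the logarithm of the number of attained values, and these come from
  \<open>S\<close>.\<close>

lemma joint_entropy_singleton_le:
  assumes "X i \<in> M \<rightarrow>\<^sub>M count_space S" and "finite S"
  shows "joint_entropy M b X {i} \<le> log b (card S)"
proof -
  have "simple_function M (X i)"
    using assms by (rule simple_function_finite_range)
  then have sf: "simple_function M (subvector X {i})"
    by (intro simple_function_subvector) auto
  have sub: "subvector X {i} ` space M \<subseteq> (\<lambda>y. \<lambda>j\<in>{i}. y) ` S"
    using measurable_space[OF assms(1)] by (force simp: subvector_def fun_eq_iff restrict_def)
  have "0 < card (subvector X {i} ` space M)"
    using sf not_empty by (simp add: simple_function_def card_gt_0_iff)
  moreover have "card (subvector X {i} ` space M) \<le> card S"
    using sub assms(2) by (meson card_image_le card_mono finite_imageI le_trans)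
  ultimately have "log b (card (subvector X {i} ` space M)) \<le> log b (card S)"
    using b_gt_1 by simp
  with entropy_le_card[OF simple_distributedI[OF sf measure_nonneg refl]]
  show ?thesis
    unfolding joint_entropy_def by linarith
qed

end

lemma subadditive_le_card:
  fixes h :: "'a set \<Rightarrow> real"
  assumes "finite A" and "h {} = 0" and "\<And>i. i \<in> A \<Longrightarrow> h {i} \<le> 1"
    and "\<And>B C. B \<union> C \<subseteq> A \<Longrightarrow> h (B \<union> C) \<le> h B + h C"
  shows "h A \<le> card A"
  using assms
proof (induction A rule: finite_induct)
  case (insert i A)
  have "h A \<le> card A"
    using insert.prems by (intro insert.IH) (auto simp: subset_insertI2)
  moreover have "h ({i} \<union> A) \<le> h {i} + h A"
    by (intro insert.prems) auto
  moreover have "h {i} \<le> 1"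
    using insert.prems by auto
  ultimately show ?case
    using insert.hyps by simp
qed simp

lemma cohesion_extremal:
  fixes h :: "'a set \<Rightarrow> real"
  assumes E: "finite E" and k: "1 \<le> k" "k < card E"
    and mono: "\<And>A. A \<subseteq> E \<Longrightarrow> h A \<le> h E"
    and card: "\<And>A. A \<subseteq> E \<Longrightarrow> h A \<le> card A"
    and eq: "(\<Sum>A | A \<subseteq> E \<and> card A = k. h A) - real ((card E - 1) choose (k - 1)) * h E
      = real k * real ((card E - 1) choose k)"
  shows "h E = k" and "\<And>A. A \<subseteq> E \<Longrightarrow> card A = k \<Longrightarrow> h A = k"
proof -
  let ?K = "{A. A \<subseteq> E \<and> card A = k}"
  \<comment> \<open>These are the two Pascal summands of the number of \<open>k\<close>-subsets;
    \<open>1 \<le> k\<close> and \<open>k < card E\<close> keep all the binomials in range and make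
    both positive, so each can be cancelled.\<close>
  define c d where "c = real ((card E - 1) choose (k - 1))" and "d = real ((card E - 1) choose k)"
  have "0 < c" "0 < d"
    using k by (auto simp: c_def d_def)
  have "card E choose k = ((card E - 1) choose (k - 1)) + ((card E - 1) choose k)"
    using k by (intro choose_reduce_nat) auto
  then have cK: "real (card ?K) = c + d"
    using E by (simp add: n_subsets c_def d_def)
  have fin: "finite ?K"
    using E by simp
  have sum: "sum h ?K = c * h E + k * d"
    using eq by (simp add: c_def d_def)
  have "sum h ?K \<le> (\<Sum>A\<in>?K. h E)"
    by (intro sum_mono mono) auto
  \<comment> \<open>The bound reads \<open>c * h E + k * d \<le> (c + d) * h E\<close>, where
    \<open>c * h E\<close> cancels.\<close>
  then have "d * k \<le> d * h E"
    by (simp only: sum cK sum_constant) (simp add: algebra_simps)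
  then have "k \<le> h E"
    using \<open>0 < d\<close> by simp
  have le: "sum h ?K \<le> (\<Sum>A\<in>?K. real k)"
    using card by (intro sum_mono) auto
  \<comment> \<open>Now \<open>c * h E + k * d \<le> (c + d) * k\<close>, where \<open>k * d\<close>
    cancels.\<close>
  then have "c * h E \<le> c * k"
    by (simp only: sum cK sum_constant) (simp add: algebra_simps)
  then have "h E \<le> k"
    using \<open>0 < c\<close> by simp
  with \<open>k \<le> h E\<close> show hE: "h E = k"
    by simp
  \<comment> \<open>Equal sums and a termwise inequality force equality in every term.\<close>
  have "sum h ?K = (\<Sum>A\<in>?K. real k)"
    by (simp only: sum hE cK sum_constant) (simp add: algebra_simps)
  moreover have "h A \<le> k" if "A \<in> ?K" for A
    using card that by auto
  ultimately show "h A = k" if "A \<subseteq> E" "card A = k" for A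
    using that fin by (intro sum_mono_inv[of h ?K "\<lambda>_. real k" A]) simp_all
qed

lemma uniform_rank_function:
  fixes h :: "'a set \<Rightarrow> real"
  assumes E: "finite E" and k: "k \<le> card E"
    and mono: "\<And>A B. A \<subseteq> B \<Longrightarrow> B \<subseteq> E \<Longrightarrow> h A \<le> h B"
    and subadd: "\<And>A B. A \<union> B \<subseteq> E \<Longrightarrow> h (A \<union> B) \<le> h A + h B"
    and card: "\<And>A. A \<subseteq> E \<Longrightarrow> h A \<le> card A"
    and top: "h E = k"
    and level: "\<And>A. A \<subseteq> E \<Longrightarrow> card A = k \<Longrightarrow> h A = k"
    and A: "A \<subseteq> E"
  shows "h A = min (card A) k"
proof (cases "card A \<le> k")
  case True
  then obtain B where B: "A \<subseteq> B" "B \<subseteq> E" "card B = k"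
    using exists_subset_between[of A k E] A E k by auto
  have "finite A"
    using A E by (rule finite_subset)
  \<comment> \<open>Here \<open>h B = k\<close>, while \<open>B - A\<close> contributes at most
    \<open>k - card A\<close>, which leaves at least \<open>card A\<close> for
    \<open>h A\<close>.\<close>
  have "h (A \<union> (B - A)) \<le> h A + h (B - A)"
    using B by (intro subadd) auto
  moreover have "A \<union> (B - A) = B"
    using B by auto
  moreover have "h (B - A) \<le> card (B - A)"
    using B by (intro card) auto
  moreover have "real (card (B - A)) = real k - card A"
    using B True \<open>finite A\<close> by (simp add: card_Diff_subset of_nat_diff)
  ultimately show ?thesis
    using level[of B] B card[OF A] True by simp
next
  case False
  then obtain B where "B \<subseteq> A" "card B = k"
    by (metis nat_le_linear obtain_subset_with_card_n)
  \<comment> \<open>\<open>h A\<close> is squeezed between \<open>h B\<close> and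
    \<open>h E\<close>, both equal to \<open>k\<close>.\<close>
  then show ?thesis
    using mono[of B A] mono[of A E] level[of B] top A False by auto
qed

lemma matroid_rank_function_uniform:
  assumes E: "finite E" and h: "\<And>A. A \<subseteq> E \<Longrightarrow> h A = real (min (card A) k)"
  shows "matroid_rank_function E h"
  unfolding matroid_rank_function_def
proof (intro conjI allI impI)
  fix S T assume "S \<subseteq> T \<and> T \<subseteq> E"
  then show "h S \<le> h T"
    using h[of S] h[of T] card_mono[of T S] finite_subset[OF _ E] by auto
next
  fix S T assume ST: "S \<subseteq> E \<and> T \<subseteq> E"
  then have fin: "finite S" "finite T"
    using finite_subset[OF _ E] by auto
  \<comment> \<open>The sizes of union and intersection have the same sum as those of
    \<open>S\<close> and \<open>T\<close> but lie further apart, so the concave truncation at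
    \<open>k\<close> can only lower their sum.\<close>
  have "card (S \<union> T) + card (S \<inter> T) = card S + card T"
    "card (S \<inter> T) \<le> card S" "card (S \<inter> T) \<le> card T"
    using fin card_Un_Int[of S T] by (auto intro: card_mono)
  then have "min (card (S \<union> T)) k + min (card (S \<inter> T)) k \<le> min (card S) k + min (card T) k"
    by linarith
  moreover have "S \<union> T \<subseteq> E" "S \<inter> T \<subseteq> E"
    using ST by auto
  ultimately show "h (S \<union> T) + h (S \<inter> T) \<le> h S + h T"
    using ST h by (simp only: of_nat_add[symmetric] of_nat_le_iff)
qed (use E h in auto)

theorem mainTheorem3:
  fixes M :: "'a measure" and X :: "nat \<Rightarrow> 'a \<Rightarrow> 'b" and S :: "nat \<Rightarrow> 'b set"
    and n k q :: nat
  assumes "1 \<le> k" and "k \<le> n - 1" and "2 \<le> q"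
    and "prob_space M"
    and "\<And>i. i \<in> {1..n} \<Longrightarrow> finite (S i) \<and> card (S i) = q"
    and "\<And>i. i \<in> {1..n} \<Longrightarrow> X i \<in> M \<rightarrow>\<^sub>M count_space (S i)"
    and "cohesion M (real q) n k X = real k * real ((n - 1) choose k)"
  shows "matroid_rank_function {1..n} (joint_entropy M (real q) X)
    \<and> indep_sets_of_rank {1..n} (joint_entropy M (real q) X) = {A. A \<subseteq> {1..n} \<and> card A \<le> k}
    \<and> matroid_isomorphic (matroid_of_rank {1..n} (joint_entropy M (real q) X)) (uniform_matroid k n)"
proof -
  interpret prob_space M by fact
  interpret information_space M "real q"
    by standard (use \<open>2 \<le> q\<close> in simp)
  let ?E = "{1..n}" and ?h = "joint_entropy M (real q) X"
  have sf: "simple_function M (X i)" if "i \<in> ?E" for i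
    using assms(5,6)[OF that] by (auto intro: simple_function_finite_range)
  have mono: "?h A \<le> ?h B" if "A \<subseteq> B" "B \<subseteq> ?E" for A B
    using that sf finite_subset[of B ?E] by (intro joint_entropy_mono) auto
  have subadd: "?h (A \<union> B) \<le> ?h A + ?h B" if "A \<union> B \<subseteq> ?E" for A B
    using that sf finite_subset[of _ ?E] by (intro joint_entropy_subadditive) auto
  \<comment> \<open>The logarithm base equals the alphabet size, so the bound \<open>log q q\<close>
    is 1.\<close>
  have single: "?h {i} \<le> 1" if "i \<in> ?E" for i
    using joint_entropy_singleton_le[of X i "S i"] assms(5,6)[OF that] \<open>2 \<le> q\<close> by simp
  have card: "?h A \<le> card A" if "A \<subseteq> ?E" for A
    using that finite_subset[of A ?E]
    by (intro subadditive_le_card joint_entropy_empty single subadd) auto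
  have k: "1 \<le> k" "k < card ?E"
    using assms(1,2) by auto
  have eq: "(\<Sum>A | A \<subseteq> ?E \<and> card A = k. ?h A) - real ((card ?E - 1) choose (k - 1)) * ?h ?E
      = real k * real ((card ?E - 1) choose k)"
    using assms(7) by (simp add: cohesion_def)
  note extremal = cohesion_extremal[OF finite_atLeastAtMost k mono[OF _ order_refl] card eq]
  have rank: "?h A = min (card A) k" if "A \<subseteq> ?E" for A
    using k(2)
    by (intro uniform_rank_function[OF _ _ mono subadd card extremal that]) auto
  \<comment> \<open>\<open>min (card A) k = card A\<close> holds exactly when
    \<open>card A \<le> k\<close>.\<close>
  have indep: "indep_sets_of_rank ?E ?h = {A. A \<subseteq> ?E \<and> card A \<le> k}"
    using rank by (auto simp: indep_sets_of_rank_def)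
  moreover have "matroid_isomorphic (matroid_of_rank ?E ?h) (uniform_matroid k n)"
    unfolding matroid_isomorphic_def matroid_of_rank_def uniform_matroid_def indep
    \<comment> \<open>Ground sets and independent sets coincide, so the identity is an
      isomorphism.\<close>
    by (intro exI[of _ id]) auto
  ultimately show ?thesis
    using matroid_rank_function_uniform[of ?E ?h k] rank by simp
qed

end
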